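(* Let $\mathcal X$ be a finite-dimensional Banach space, let $\mathbf F:\mathcal X\to\overline{I(\mathbb R)}$ be an extended interval-valued function and let $\bar x\in\operatorname{argmin}_{x\in\mathcal X}\mathbf F(x)$. If $\mathbf F$ has a $gH$-Gâteaux derivative at $\bar x$ in every direction $h\in\mathcal X$, then $\mathbf F_{\mathscr G}(\bar x)(h)=\mathbf 0$ for all $h\in\mathcal X$.
   Context: $I(\mathbb R)$ is the set of closed bounded intervals $\mathbf A=[\underline a,\overline a]\subset\mathbb R$, $\underline a\le\overline a$; $\mathbf 0=[0,0]$. Operations: $[\underline a,\overline a]\oplus[\underline b,\overline b]=[\underline a+\underline b,\overline a+\overline b]$; $\mu\odot[\underline a,\overline a]=[\mu\underline a,\mu\overline a]$ if $\mu\ge0$ and $[\mu\overline a,\mu\underline a]$ if $\mu<0$; $[\underline a,\overline a]\ominus_{gH}[\underline b,\overline b]=[\min\{\underline a-\underline b,\overline a-\overline b\},\max\{\underline a-\underline b,\overline a-\overline b\}]$. Norm: $\|[\underline a,\overline a]\|_{I(\mathbb R)}=\max\{|\underline a|,|\overline a|\}$. Order: $[\underline a,\overline a]\preceq[\underline b,\overline b]$ iff $\underline a\le\underline b$ and $\overline a\le\overline b$; $\mathbf A\prec\mathbf B$ iff $\mathbf A\preceq\mathbf B$ and $\mathbf A\neq\mathbf B$. One of $\mathbf A,\mathbf B$ dominates the other if $\mathbf A\preceq\mathbf B$ or $\mathbf B\preceq\mathbf A$. $\overline{I(\mathbb R)}=I(\mathbb R)\cup\{-\infty,+\infty\}$,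 where $\pm\infty$ is identified with $[\pm\infty,\pm\infty]$ and $-\infty\prec\mathbf A\prec+\infty$ for all $\mathbf A\in I(\mathbb R)$. $\inf_{\mathcal X}\mathbf F$ is the greatest lower bound of $\{\mathbf F(x):x\in\mathcal X\}$ with respect to $\preceq$ in $\overline{I(\mathbb R)}$ (computed endpointwise when it lies in $I(\mathbb R)$). $\operatorname{argmin}_{x\in\mathcal X}\mathbf F(x)=\{x\in\mathcal X:\mathbf F(x)=\inf_{y\in\mathcal X}\mathbf F(y)\}$ if $\inf_{\mathcal X}\mathbf F\ne+\infty$, and $\emptyset$ otherwise. $\mathbf G:\mathcal X\to I(\mathbb R)$ is $gH$-continuous at $y$ if for each $\eta>0$ there is $r>0$ with $\|\mathbf G(x)\ominus_{gH}\mathbf G(y)\|_{I(\mathbb R)}<\eta$ whenever $\|x-y\|_{\mathcal X}<r$. $\mathbf G:\mathcal X\to I(\mathbb R)$ is a linear IVF if (a) $\mathbf G(\lambda x)=\lambda\odot\mathbf G(x)$ for all $x\in\mathcal X$, $\lambda\in\mathbb R$, and (b) for all $x,y\in\mathcal X$, either $\mathbf G(x)\oplus\mathbf G(y)=\mathbf G(x+y)$ or neither of $\mathbf G(x)\oplus\mathbf G(y)$ and $\mathbf G(x+y)$ dominates the other. $\mathbf F$ has a $gH$-Gâteaux derivative $\mathbf F_{\mathscr G}(\bar x)$ at $\bar x$ if the limit $\mathbf F_{\mathscr G}(\bar x)(h)=\lim_{\lambda\to0+}\frac1\lambda\odot(\mathbf F(\bar x+\lambda h)\ominus_{gH}\mathbf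 F(\bar x))$ exists in $I(\mathbb R)$ (with respect to $\|\cdot\ominus_{gH}\cdot\|_{I(\mathbb R)}$) for all $h\in\mathcal X$ and $\mathbf F_{\mathscr G}(\bar x)$ is a $gH$-continuous linear IVF from $\mathcal X$ to $I(\mathbb R)$. *)

theory Defs
  imports "HOL-Analysis.Analysis" "HOL-Library.Interval" "HOL-Library.Extended"
begin

text \<open>
  \<open>I(\<real>)\<close> is the library type \<^typ>\<open>real interval\<close>; its \<open>+\<close> and \<open>0\<close> are the operation \<open>\<oplus>\<close> and
  \<open>[0, 0]\<close> of interval analysis. Its \<open>-\<close> is the Minkowski difference and its \<open>\<le>\<close> is set
  inclusion, so neither can be used for the gH-difference and the endpointwise order.
\<close>

definition ivl_scale :: "real \<Rightarrow> real interval \<Rightarrow> real interval" (infixr \<open>\<odot>\<close> 75) where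
  "m \<odot> A = Interval (if m \<ge> 0 then (m * lower A, m * upper A) else (m * upper A, m * lower A))"

definition gH_diff :: "real interval \<Rightarrow> real interval \<Rightarrow> real interval" (infixl \<open>\<ominus>\<close> 65) where
  "A \<ominus> B = Interval (min (lower A - lower B) (upper A - upper B),
                     max (lower A - lower B) (upper A - upper B))"

lemma bounds_Interval: "a \<le> b \<Longrightarrow> lower (Interval (a, b)) = a \<and> upper (Interval (a, b)) = b"
  for a b :: real
  by (simp add: lower.rep_eq upper.rep_eq Interval_inverse)

lemma lower_upper_ivl_scale:
  "lower (m \<odot> A) = (if m \<ge> 0 then m * lower A else m * upper A)"
  "upper (m \<odot> A) = (if m \<ge> 0 then m * upper A else m * lower A)"
  by (auto simp: ivl_scale_def bounds_Interval mult_left_mono mult_left_mono_neg)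

lemma lower_upper_gH_diff:
  "lower (A \<ominus> B) = min (lower A - lower B) (upper A - upper B)"
  "upper (A \<ominus> B) = max (lower A - lower B) (upper A - upper B)"
  by (auto simp: gH_diff_def bounds_Interval)

definition ivl_norm :: "real interval \<Rightarrow> real" where
  "ivl_norm A = max \<bar>lower A\<bar> \<bar>upper A\<bar>"

definition ivl_le :: "real interval \<Rightarrow> real interval \<Rightarrow> bool" (infix \<open>\<preceq>\<close> 50) where
  "A \<preceq> B \<longleftrightarrow> lower A \<le> lower B \<and> upper A \<le> upper B"

text \<open>
  The extended intervals are \<^typ>\<open>real interval extended\<close>, with \<^const>\<open>Minf\<close> and \<^const>\<open>Pinf\<close>
  the two infinite elements. The library order on this type extends set inclusion, so the
  extension of \<open>\<preceq>\<close> is defined separately.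
\<close>

fun ext_le :: "real interval extended \<Rightarrow> real interval extended \<Rightarrow> bool" (infix \<open>\<preceq>\<^sub>e\<close> 50) where
  "Fin A \<preceq>\<^sub>e Fin B \<longleftrightarrow> A \<preceq> B"
| "Minf \<preceq>\<^sub>e _ \<longleftrightarrow> True"
| "Fin _ \<preceq>\<^sub>e Pinf \<longleftrightarrow> True"
| "Fin _ \<preceq>\<^sub>e Minf \<longleftrightarrow> False"
| "Pinf \<preceq>\<^sub>e y \<longleftrightarrow> y = Pinf"

definition is_ext_glb :: "real interval extended set \<Rightarrow> real interval extended \<Rightarrow> bool" where
  "is_ext_glb S g \<longleftrightarrow> (\<forall>y\<in>S. g \<preceq>\<^sub>e y) \<and> (\<forall>l. (\<forall>y\<in>S. l \<preceq>\<^sub>e y) \<longrightarrow> l \<preceq>\<^sub>e g)"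

definition IVF_inf :: "'a set \<Rightarrow> ('a \<Rightarrow> real interval extended) \<Rightarrow> real interval extended" where
  "IVF_inf X F = (THE g. is_ext_glb (F ` X) g)"

lemma ext_le_antisym: "x \<preceq>\<^sub>e y \<Longrightarrow> y \<preceq>\<^sub>e x \<Longrightarrow> x = y"
  by (cases x; cases y) (auto simp: ivl_le_def interval_eq_iff)

lemma ex1_is_ext_glb: "\<exists>!g. is_ext_glb S g"
proof (rule ex_ex1I)
  fix g g' assume "is_ext_glb S g" "is_ext_glb S g'"
  then show "g = g'" by (auto simp: is_ext_glb_def intro: ext_le_antisym)
next
  show "\<exists>g. is_ext_glb S g"
  proof (cases "\<exists>L. \<forall>y\<in>S. Fin L \<preceq>\<^sub>e y")
    case False
    have "l = Minf" if l: "\<forall>y\<in>S. l \<preceq>\<^sub>e y" for l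
    proof (cases l)
      case Pinf
      then have "\<forall>y\<in>S. Fin 0 \<preceq>\<^sub>e y" using l by auto
      with False show ?thesis by blast
    qed (use l False in auto)
    then have "is_ext_glb S Minf" unfolding is_ext_glb_def using ext_le.simps(2) by metis
    then show ?thesis by blast
  next
    case True
    then obtain L where L: "\<forall>y\<in>S. Fin L \<preceq>\<^sub>e y" by blast
    define R where "R = {A. Fin A \<in> S}"
    have S: "y = Pinf \<or> (\<exists>A\<in>R. y = Fin A)" if "y \<in> S" for y
      using L[rule_format, OF that] that by (cases y) (auto simp: R_def)
    show ?thesis
    proof (cases "R = {}")
      case True
      then have "is_ext_glb S Pinf"
        using S by (auto simp: is_ext_glb_def) (metis ext_le.simps extended.exhaust)
      then show ?thesis by blast
    next
      case False
      have LR: "L \<preceq> A" if "A \<in> R" for A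
        using L that by (auto simp: R_def)
      have bl: "bdd_below (lower ` R)" and bu: "bdd_below (upper ` R)"
        using LR by (auto simp: ivl_le_def bdd_below_def)
      have le: "(INF A\<in>R. lower A) \<le> (INF A\<in>R. upper A)"
        using False bl lower_le_upper by (intro cINF_mono) blast+
      define G where "G = Interval (INF A\<in>R. lower A, INF A\<in>R. upper A)"
      have G: "lower G = (INF A\<in>R. lower A)" "upper G = (INF A\<in>R. upper A)"
        using le by (auto simp: G_def bounds_Interval)
      have "Fin G \<preceq>\<^sub>e y" if "y \<in> S" for y
        using S[OF that] bl bu by (auto simp: ivl_le_def G intro: cINF_lower)
      moreover have "l \<preceq>\<^sub>e Fin G" if l: "\<forall>y\<in>S. l \<preceq>\<^sub>e y" for l
      proof (cases l)
        case (Fin A)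
        then show ?thesis
          using l False by (auto simp: ivl_le_def G R_def intro!: cINF_greatest)
      qed (use l False in \<open>auto simp: R_def\<close>)
      ultimately have "is_ext_glb S (Fin G)" by (auto simp: is_ext_glb_def)
      then show ?thesis by blast
    qed
  qed
qed

lemma is_ext_glb_IVF_inf: "is_ext_glb (F ` X) (IVF_inf X F)"
  unfolding IVF_inf_def by (rule theI') (rule ex1_is_ext_glb)

definition IVF_argmin :: "'a set \<Rightarrow> ('a \<Rightarrow> real interval extended) \<Rightarrow> 'a set" where
  "IVF_argmin X F = (if IVF_inf X F \<noteq> Pinf then {x \<in> X. F x = IVF_inf X F} else {})"

definition gH_continuous_at :: "('a::real_normed_vector \<Rightarrow> real interval) \<Rightarrow> 'a \<Rightarrow> bool" where
  "gH_continuous_at G y \<longleftrightarrow>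
    (\<forall>\<eta>>0. \<exists>r>0. \<forall>x. norm (x - y) < r \<longrightarrow> ivl_norm (G x \<ominus> G y) < \<eta>)"

definition linear_IVF :: "('a::real_vector \<Rightarrow> real interval) \<Rightarrow> bool" where
  "linear_IVF G \<longleftrightarrow>
    (\<forall>x c. G (c *\<^sub>R x) = c \<odot> G x) \<and>
    (\<forall>x y. G x + G y = G (x + y) \<or>
           \<not> (G x + G y \<preceq> G (x + y) \<or> G (x + y) \<preceq> G x + G y))"

text \<open>
  The limit of the difference quotients is taken in \<open>I(\<real>)\<close>, and the gH-difference is only defined
  there: hence \<open>F\<close> has to be finite at \<open>x\<close> and, for each direction \<open>h\<close>, at \<open>x + t h\<close> for all
  sufficiently small \<open>t > 0\<close> (how small may depend on \<open>h\<close>).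
\<close>

definition has_gH_Gateaux_derivative ::
    "('a::real_normed_vector \<Rightarrow> real interval extended) \<Rightarrow> ('a \<Rightarrow> real interval) \<Rightarrow> 'a \<Rightarrow> bool" where
  "has_gH_Gateaux_derivative F G x \<longleftrightarrow>
    (\<exists>A. F x = Fin A \<and>
      (\<forall>h. \<forall>\<epsilon>>0. \<forall>\<^sub>F t in at_right 0.
        \<exists>B. F (x + t *\<^sub>R h) = Fin B \<and> ivl_norm ((1 / t) \<odot> (B \<ominus> A) \<ominus> G h) < \<epsilon>)) \<and>
    linear_IVF G \<and> (\<forall>y. gH_continuous_at G y)"

end

theory Submission
  imports Defs
begin

text \<open>
  At a minimizer every difference quotient dominates \<open>0\<close>: the infimum is a lower bound, so both
  endpoints of \<open>F\<close> can only grow when \<open>x\<close> is left, and the gH-difference collects exactly these two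
  nonnegative increments. Domination of \<open>0\<close> is a closed condition, hence it passes to the
  derivative in every direction (\<open>minimizer_imp_gH_derivative_nonneg\<close>). The direction \<open>- h\<close> then
  gives the opposite inequality for \<open>h\<close>: by homogeneity the derivative along \<open>- h\<close> is the
  reflection \<open>[- u, - l]\<close> of the derivative \<open>[l, u]\<close> along \<open>h\<close>, so \<open>0 \<le> l\<close> and \<open>u \<le> 0\<close> hold
  together, and \<open>l \<le> u\<close> forces \<open>[l, u] = 0\<close>.
\<close>

lemma IVF_argmin_le:
  assumes "x \<in> IVF_argmin X F" and "y \<in> X"
  shows "F x \<preceq>\<^sub>e F y"
  using assms is_ext_glb_IVF_inf[of F X]
  by (auto simp: IVF_argmin_def is_ext_glb_def split: if_splits)

text \<open>
  The gH-difference may interchange the two endpoint differences, but its norm does not see the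
  order: it is the sup distance of the pairs of endpoints, so limits can be taken endpointwise.
\<close>

lemma ivl_norm_gH_diff:
  "ivl_norm (A \<ominus> B) = max \<bar>lower A - lower B\<bar> \<bar>upper A - upper B\<bar>"
  by (auto simp: ivl_norm_def lower_upper_gH_diff min_def max_def)

lemma zero_ivl_le_scaled_gH_diff:
  assumes "A \<preceq> B" and "0 \<le> c"
  shows "0 \<preceq> c \<odot> (B \<ominus> A)"
  using assms by (auto simp: ivl_le_def lower_upper_ivl_scale lower_upper_gH_diff)

text \<open>
  A limit of intervals dominating \<open>0\<close> dominates \<open>0\<close>: an interval that is \<open>\<epsilon>\<close>-close to a difference
  quotient has both endpoints above \<open>- \<epsilon>\<close>, and \<open>\<epsilon>\<close> is arbitrary.
\<close>

lemma minimizer_imp_gH_derivative_nonneg: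
  assumes min: "\<And>y. Fin A \<preceq>\<^sub>e F y"
    and lim: "\<And>\<epsilon>. \<epsilon> > 0 \<Longrightarrow> \<forall>\<^sub>F t in at_right 0.
        \<exists>B. F (x + t *\<^sub>R h) = Fin B \<and> ivl_norm ((1 / t) \<odot> (B \<ominus> A) \<ominus> D) < \<epsilon>"
  shows "0 \<preceq> D"
proof -
  have "0 \<le> lower D + \<epsilon> \<and> 0 \<le> upper D + \<epsilon>" if "\<epsilon> > 0" for \<epsilon>
  proof -
    have "\<forall>\<^sub>F t in at_right (0::real). t > 0 \<and>
        (\<exists>B. F (x + t *\<^sub>R h) = Fin B \<and> ivl_norm ((1 / t) \<odot> (B \<ominus> A) \<ominus> D) < \<epsilon>)"
      by (intro eventually_conj eventually_at_right_less lim that)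
    then obtain t B where "t > 0" and B: "F (x + t *\<^sub>R h) = Fin B"
      and close: "ivl_norm ((1 / t) \<odot> (B \<ominus> A) \<ominus> D) < \<epsilon>"
      using eventually_happens'[OF trivial_limit_at_right_real] by blast
    have "A \<preceq> B"
      using min[of "x + t *\<^sub>R h"] B by simp
    then have "0 \<preceq> (1 / t) \<odot> (B \<ominus> A)"
      using \<open>t > 0\<close> by (intro zero_ivl_le_scaled_gH_diff) auto
    with close show ?thesis
      by (auto simp: ivl_norm_gH_diff ivl_le_def)
  qed
  then show ?thesis
    by (auto simp: ivl_le_def intro: field_le_epsilon)
qed

lemma ivl_eq_zero_if_reflection_nonneg:
  assumes "0 \<preceq> D" and "0 \<preceq> (- 1) \<odot> D"
  shows "D = 0"
  using assms lower_le_upper[of D]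
  by (auto simp: ivl_le_def lower_upper_ivl_scale interval_eq_iff)

theorem theorem3p25:
  fixes F :: "'a::banach \<Rightarrow> real interval extended"
    and F\<^sub>G :: "'a \<Rightarrow> real interval"
    and x :: 'a
  assumes "\<exists>B::'a set. finite B \<and> span B = UNIV"
    and "x \<in> IVF_argmin UNIV F"
    and "has_gH_Gateaux_derivative F F\<^sub>G x"
  shows "\<forall>h. F\<^sub>G h = 0"
proof
  fix h
  obtain A where A: "F x = Fin A"
    and lim: "\<And>h \<epsilon>. \<epsilon> > 0 \<Longrightarrow> \<forall>\<^sub>F t in at_right 0.
        \<exists>B. F (x + t *\<^sub>R h) = Fin B \<and> ivl_norm ((1 / t) \<odot> (B \<ominus> A) \<ominus> F\<^sub>G h) < \<epsilon>"
    and lin: "linear_IVF F\<^sub>G"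
    using assms(3) unfolding has_gH_Gateaux_derivative_def by blast
  have "Fin A \<preceq>\<^sub>e F y" for y
    using IVF_argmin_le[OF assms(2), of y] A by simp
  then have nonneg: "0 \<preceq> F\<^sub>G k" for k
    using lim by (rule minimizer_imp_gH_derivative_nonneg)
  have "F\<^sub>G ((- 1) *\<^sub>R h) = (- 1) \<odot> F\<^sub>G h"
    using lin unfolding linear_IVF_def by blast
  then show "F\<^sub>G h = 0"
    using nonneg[of h] nonneg[of "(- 1) *\<^sub>R h"]
    by (intro ivl_eq_zero_if_reflection_nonneg) auto
qed

end
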